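(* Let $d=2^{n+1}$ be the dimension of an $(n+1)$-qubit system, let $r\in(0,1]$ be a known constant, and let $$\rho_{G,r}(\theta,N_{\mathrm q})=r^{N_{\mathrm q}}|\psi_G(\theta,N_{\mathrm q})\rangle\langle\psi_G(\theta,N_{\mathrm q})|+(1-r^{N_{\mathrm q}})\frac{\mathbf{I}_{n+1}}{d},$$ $$|\psi_G(\theta,N_{\mathrm q})\rangle=\cos(N_{\mathrm q}\theta)|\psi_0\rangle_n|0\rangle+\sin(N_{\mathrm q}\theta)|\psi_1\rangle_n|1\rangle,$$ with $|\psi_0\rangle_n,|\psi_1\rangle_n$ normalized $n$-qubit states and $\theta$ an unknown parameter. Let $F_{\mathrm q,G,r}(\theta,N_{\mathrm q})$ be the quantum Fisher information about $\theta$ of $\rho_{G,r}(\theta,N_{\mathrm q})$, let $F_{\mathrm c,G,r}(\theta,N_{\mathrm q})$ be the classical Fisher information about $\theta$ of the outcome distribution obtained by measuring $\rho_{G,r}(\theta,N_{\mathrm q})$ with $E_{G,i}=\mathbf{I}_n\otimes|i\rangle\langle i|$, $i\in\{0,1\}$, and let $F_{\mathrm c,G,r}(N_{\mathrm q})|_{\mathrm{env}}$ be the $\theta$-independent upper envelope of $F_{\mathrm c,G,r}(\theta,N_{\mathrm q})$. Then $F_{\mathrm q,G,r}(\theta,N_{\mathrm q})$ does not depend on $\theta$, and for any value of $\theta$ $$F_{\mathrm q,G,r}(\theta,N_{\mathrm q})\ge F_{\mathrm c,G,r}(N_{\mathrm q})|_{\mathrm{env}}\ge F_{\mathrm c,G,r}(\theta,N_{\mathrm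 q}).$$ Moreover: (i) if $d=2$ (a single qubit), then $F_{\mathrm q,G,r}(\theta,N_{\mathrm q})=F_{\mathrm c,G,r}(N_{\mathrm q})|_{\mathrm{env}}$; (ii) if $d>2$ (two or more qubits), then $F_{\mathrm q,G,r}(\theta,N_{\mathrm q})>F_{\mathrm c,G,r}(N_{\mathrm q})|_{\mathrm{env}}$.
   Context: $\mathbf{I}_k$ is the identity on $k$ qubits. The classical Fisher information of a distribution $p(i;\theta)=\mathrm{Tr}(\rho(\theta)E_i)$, $i\in\{0,1\}$, is $\sum_i\left(\partial_\theta\ln p(i;\theta)\right)^2p(i;\theta)$. The quantum Fisher information of a family of states $\rho(\theta)$ is $\mathrm{Tr}(\rho(\theta)L^2)$, where $L$ is the symmetric logarithmic derivative, i.e. the Hermitian operator with $\partial_\theta\rho=\frac12(\rho L+L\rho)$. The explicit values are $F_{\mathrm c,G,r}(N_{\mathrm q})|_{\mathrm{env}}=4N_{\mathrm q}^2r^{2N_{\mathrm q}}$ and $$F_{\mathrm q,G,r}(\theta,N_{\mathrm q})=\frac{4N_{\mathrm q}^2r^{2N_{\mathrm q}}}{\frac2d+\left(1-\frac2d\right)r^{N_{\mathrm q}}}.$$ Origin of the family: for a unitary $A$ with $A|0\rangle_{n+1}=\cos\theta|\psi_0\rangle_n|0\rangle+\sin\theta|\psi_1\rangle_n|1\rangle$ and $G=AU_0A^\dagger U_f$, where $U_0=-\mathbf{I}_{n+1}+2|0\rangle_{n+1}\langle0|_{n+1}$ and $U_f=-\mathbf{I}_{n+1}+2\mathbf{I}_n\otimes|0\rangle\langle0|$,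 the state $\rho_{G,r}(\theta,2m+1)$ results from $G^mA|0\rangle_{n+1}$ when the depolarizing channel $\mathcal{D}(\rho)=r\rho+(1-r)\mathbf{I}_{n+1}/d$ acts at every use of $A$ or $A^\dagger$. $N_{\mathrm q}$ is the number of uses of $A$ and $A^\dagger$, and the state is treated as a function of a general $N_{\mathrm q}$.
   Formalization: Part (ii) is stated for r < 1 only: at r = 1 both quantities equal 4N_q^2 for every d, so the strict inequality fails there. N_q is taken to be a positive real number (at N_q = 0 all informations vanish and (ii) fails). *)

theory Defs
  imports "HOL-Analysis.Analysis"
begin

text \<open>
  A finite-dimensional Hilbert space with an orthonormal basis labelled by a finite type
  is a space of complex coordinate vectors; a tensor product is labelled by the product type.
  A qubit is labelled by the numeral type \<open>2\<close>, with elements \<open>0\<close> and \<open>1\<close>, and \<open>n\<close> qubits by any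
  type with \<open>2 ^ n\<close> elements (for \<open>n = 0\<close>, a one-element type).
\<close>

definition ket :: "'a::finite \<Rightarrow> complex ^ 'a"
  where "ket i = axis i 1"

definition outer :: "complex ^ 'a \<Rightarrow> complex ^ 'b \<Rightarrow> complex ^ 'b ^ 'a"
  where "outer u v = (\<chi> i j. u $ i * cnj (v $ j))"

definition tensor_vec :: "complex ^ 'a \<Rightarrow> complex ^ 'b \<Rightarrow> complex ^ ('a \<times> 'b)"
  where "tensor_vec u v = (\<chi> p. u $ fst p * v $ snd p)"

definition tensor_mat ::
    "complex ^ 'a ^ 'a \<Rightarrow> complex ^ 'b ^ 'b \<Rightarrow> complex ^ ('a \<times> 'b) ^ ('a \<times> 'b)"
  where "tensor_mat A B = (\<chi> p q. A $ fst p $ fst q * B $ snd p $ snd q)"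

definition hermitian_mat :: "complex ^ 'a ^ 'a \<Rightarrow> bool"
  where "hermitian_mat A \<longleftrightarrow> (\<forall>i j. A $ i $ j = cnj (A $ j $ i))"


definition is_SLD ::
    "(real \<Rightarrow> complex ^ 'a ^ 'a) \<Rightarrow> real \<Rightarrow> complex ^ 'a ^ 'a::finite \<Rightarrow> bool"
  where "is_SLD \<rho> \<theta> L \<longleftrightarrow> hermitian_mat L \<and>
    (\<rho> has_vector_derivative (1/2) *\<^sub>R (\<rho> \<theta> ** L + L ** \<rho> \<theta>)) (at \<theta>)"

text \<open>
  When \<open>\<rho> \<theta>\<close> is singular there can be several symmetric logarithmic derivatives, but they all give
  the same trace; hence the definite description ranges over the value, not over the operator.
\<close>

definition quantum_fisher :: "(real \<Rightarrow> complex ^ 'a ^ 'a::finite) \<Rightarrow> real \<Rightarrow> real"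
  where "quantum_fisher \<rho> \<theta> =
    (THE F. \<exists>L. is_SLD \<rho> \<theta> L \<and> complex_of_real F = trace (\<rho> \<theta> ** (L ** L)))"

text \<open>
  At a parameter value where some \<open>p i \<theta>\<close> vanishes, the corresponding summand is \<open>0\<close>.
\<close>

definition classical_fisher :: "('i::finite \<Rightarrow> real \<Rightarrow> real) \<Rightarrow> real \<Rightarrow> real"
  where "classical_fisher p \<theta> = (\<Sum>i\<in>UNIV. (deriv (\<lambda>t. ln (p i t)) \<theta>)\<^sup>2 * p i \<theta>)"


text \<open>
  The query count \<open>N\<close> is a general real number, so the noise factor is \<open>r powr N\<close>.
\<close>

definition psi_G ::
    "real \<Rightarrow> complex ^ 'n \<Rightarrow> complex ^ 'n \<Rightarrow> real \<Rightarrow> complex ^ ('n \<times> 2)"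
  where "psi_G N \<psi>\<^sub>0 \<psi>\<^sub>1 \<theta> =
    cos (N * \<theta>) *\<^sub>R tensor_vec \<psi>\<^sub>0 (ket 0) + sin (N * \<theta>) *\<^sub>R tensor_vec \<psi>\<^sub>1 (ket 1)"

definition rho_G ::
    "real \<Rightarrow> real \<Rightarrow> complex ^ 'n \<Rightarrow> complex ^ 'n \<Rightarrow> real \<Rightarrow> complex ^ ('n::finite \<times> 2) ^ ('n \<times> 2)"
  where "rho_G r N \<psi>\<^sub>0 \<psi>\<^sub>1 \<theta> =
    (r powr N) *\<^sub>R outer (psi_G N \<psi>\<^sub>0 \<psi>\<^sub>1 \<theta>) (psi_G N \<psi>\<^sub>0 \<psi>\<^sub>1 \<theta>)
    + ((1 - r powr N) / real CARD('n \<times> 2)) *\<^sub>R mat 1"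

definition E_G :: "2 \<Rightarrow> complex ^ ('n::finite \<times> 2) ^ ('n \<times> 2)"
  where "E_G i = tensor_mat (mat 1) (outer (ket i) (ket i))"

definition prob_G ::
    "real \<Rightarrow> real \<Rightarrow> complex ^ 'n \<Rightarrow> complex ^ 'n::finite \<Rightarrow> 2 \<Rightarrow> real \<Rightarrow> real"
  where "prob_G r N \<psi>\<^sub>0 \<psi>\<^sub>1 i \<theta> = Re (trace (rho_G r N \<psi>\<^sub>0 \<psi>\<^sub>1 \<theta> ** E_G i))"

definition F_q :: "real \<Rightarrow> real \<Rightarrow> complex ^ 'n \<Rightarrow> complex ^ 'n::finite \<Rightarrow> real \<Rightarrow> real"
  where "F_q r N \<psi>\<^sub>0 \<psi>\<^sub>1 \<theta> = quantum_fisher (rho_G r N \<psi>\<^sub>0 \<psi>\<^sub>1) \<theta>"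

definition F_c :: "real \<Rightarrow> real \<Rightarrow> complex ^ 'n \<Rightarrow> complex ^ 'n::finite \<Rightarrow> real \<Rightarrow> real"
  where "F_c r N \<psi>\<^sub>0 \<psi>\<^sub>1 \<theta> = classical_fisher (prob_G r N \<psi>\<^sub>0 \<psi>\<^sub>1) \<theta>"

text \<open>
  The upper envelope is the least \<open>\<theta>\<close>-independent upper bound; the closed form
  \<open>4 * N\<^sup>2 * r powr (2 * N)\<close> is not built in.
\<close>

definition F_c_env :: "real \<Rightarrow> real \<Rightarrow> complex ^ 'n \<Rightarrow> complex ^ 'n::finite \<Rightarrow> real"
  where "F_c_env r N \<psi>\<^sub>0 \<psi>\<^sub>1 = (SUP \<theta>. F_c r N \<psi>\<^sub>0 \<psi>\<^sub>1 \<theta>)"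

end

theory Submission
  imports Defs
begin

text \<open>
  For a symmetric logarithmic derivative \<open>L\<close>, cyclicity of the trace gives \<open>Tr (\<rho> L\<^sup>2) = Tr (L \<rho>')\<close>, and
  the same computation with two of them shows that this value does not depend on the choice of \<open>L\<close>.
  With \<open>s = r powr N\<close>, \<open>m = d / 2\<close> and \<open>\<phi>\<close> the unit vector with \<open>\<psi>' = N \<phi>\<close>, one solution is a
  multiple of \<open>|\<phi>\<rangle>\<langle>\<psi>| + |\<psi>\<rangle>\<langle>\<phi>|\<close>, so that the quantum Fisher information is
  \<open>4 N\<^sup>2 s\<^sup>2 / (s + (1 - s) / m)\<close>. The outcome probabilities are \<open>(1 \<plusminus> s cos (2 N \<theta>)) / 2\<close>, so that
  the classical one is \<open>4 N\<^sup>2 s\<^sup>2 sin\<^sup>2 (2 N \<theta>) / (1 - s\<^sup>2 cos\<^sup>2 (2 N \<theta>))\<close>, with maximum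
  \<open>4 N\<^sup>2 s\<^sup>2\<close> at \<open>\<theta> = \<pi> / (4 N)\<close>. The theorem compares the denominator \<open>s + (1 - s) / m\<close> with \<open>1\<close>.
\<close>

section \<open>Uniqueness of the value of the quantum Fisher information\<close>

lemma quantum_fisher_eqI:
  assumes L: "is_SLD \<rho> \<theta> L" and F: "trace (\<rho> \<theta> ** (L ** L)) = complex_of_real F"
  shows "quantum_fisher \<rho> \<theta> = F"
proof -
  \<comment> \<open>Both anticommutators are twice the same derivative, so the one of
    \<open>A\<close> may be replaced by the one of \<open>B\<close> under the trace. The right-hand
    side is symmetric in \<open>A\<close> and \<open>B\<close>; exchanging them equates the two
    values.\<close>
  have half_anti: "2 * trace (\<rho> \<theta> ** (A ** A)) = trace (\<rho> \<theta> ** (A ** B)) + trace (\<rho> \<theta> ** (B ** A))"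
    if A: "is_SLD \<rho> \<theta> A" and B: "is_SLD \<rho> \<theta> B" for A B
  proof -
    have "(1/2) *\<^sub>R (\<rho> \<theta> ** A + A ** \<rho> \<theta>) = (1/2) *\<^sub>R (\<rho> \<theta> ** B + B ** \<rho> \<theta>)"
      using A B vector_derivative_unique_at unfolding is_SLD_def by blast
    then have eq: "\<rho> \<theta> ** A + A ** \<rho> \<theta> = \<rho> \<theta> ** B + B ** \<rho> \<theta>"
      by simp
    have tr: "trace (A ** (\<rho> \<theta> ** C + C ** \<rho> \<theta>)) = trace (\<rho> \<theta> ** (A ** C)) + trace (\<rho> \<theta> ** (C ** A))" for C
      by (metis matrix_add_ldistrib matrix_mul_assoc trace_add trace_mul_sym add.commute)
    show ?thesis
      using tr [of A] tr [of B] unfolding eq by simp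
  qed
  have "trace (\<rho> \<theta> ** (M ** M)) = complex_of_real F" if "is_SLD \<rho> \<theta> M" for M
  proof -
    have "2 * trace (\<rho> \<theta> ** (M ** M)) = 2 * trace (\<rho> \<theta> ** (L ** L))"
      unfolding half_anti [OF that L] half_anti [OF L that] by (rule add.commute)
    then show ?thesis using F by simp
  qed
  then show ?thesis
    unfolding quantum_fisher_def using L F by (intro the_equality) auto
qed

section \<open>Hermitian inner product and rank-one operators\<close>

text \<open>Conjugate-linear in the first argument, as in bra-ket notation; \<open>inner u v\<close>
  is only its real part.\<close>

definition cdot :: "complex ^ 'a::finite \<Rightarrow> complex ^ 'a \<Rightarrow> complex"
  where "cdot u v = (\<Sum>i\<in>UNIV. cnj (u $ i) * v $ i)"

lemma cdot_self: "cdot u u = complex_of_real ((norm u)\<^sup>2)"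
  by (simp add: cdot_def norm_vec_def L2_set_def sum_nonneg complex_norm_square mult.commute
      del: of_real_power)

lemma cdot_add_right: "cdot u (v + w) = cdot u v + cdot u w"
  by (simp add: cdot_def sum.distrib distrib_left)

lemma cdot_add_left: "cdot (u + v) w = cdot u w + cdot v w"
  by (simp add: cdot_def sum.distrib distrib_right)

lemma cdot_scaleR_right: "cdot u (c *\<^sub>R v) = of_real c * cdot u v"
  by (simp add: cdot_def scaleR_sum_right flip: scaleR_conv_of_real)

lemma cdot_scaleR_left: "cdot (c *\<^sub>R u) v = of_real c * cdot u v"
  by (simp add: cdot_def scaleR_sum_right flip: scaleR_conv_of_real)

lemma cdot_tensor: "cdot (tensor_vec a x) (tensor_vec b y) = cdot a b * cdot x y"
proof -
  have "cdot (tensor_vec a x) (tensor_vec b y)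
      = (\<Sum>p\<in>UNIV \<times> UNIV. (cnj (a $ fst p) * b $ fst p) * (cnj (x $ snd p) * y $ snd p))"
    by (simp add: cdot_def tensor_vec_def mult_ac)
  also have "\<dots> = cdot a b * cdot x y"
    by (simp add: cdot_def sum_product sum.cartesian_product case_prod_beta)
  finally show ?thesis .
qed

lemma cdot_ket: "cdot (ket i) (ket j) = (if i = j then 1 else 0)"
  by (simp add: cdot_def ket_def axis_def if_distrib [of "\<lambda>x. x * _"] if_distrib [of cnj] cong: if_cong)

lemma trace_outer: "trace (outer u v) = cdot v u"
  by (simp add: trace_def outer_def cdot_def mult.commute)

text \<open>The coefficient \<open>cdot v w\<close> is complex, so the multiple is written entrywise
  instead of with \<open>scaleR\<close>.\<close>

lemma outer_mult_outer: "outer u v ** outer w z = (\<chi> i j. cdot v w * outer u z $ i $ j)"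
  by (simp add: matrix_matrix_mult_def outer_def cdot_def vec_eq_iff sum_distrib_left
      sum_distrib_right mult_ac)

lemma matrix_add_rdistrib: "(A + B) ** C = A ** C + B ** (C :: 'a::semiring_1 ^ _ ^ _)"
  by (simp add: matrix_matrix_mult_def vec_eq_iff distrib_right sum.distrib)

lemma trace_scaleR: "trace (c *\<^sub>R A) = of_real c * trace (A :: complex ^ 'a ^ 'a::finite)"
  by (simp add: trace_def scaleR_sum_right flip: scaleR_conv_of_real)

text \<open>Being antilinear in its second argument, \<open>outer\<close> is bilinear over the reals
  only; this suffices for the product rule in a real parameter.\<close>

lemma bounded_bilinear_outer:
  "bounded_bilinear (outer :: complex ^ 'a::finite \<Rightarrow> complex ^ 'b::finite \<Rightarrow> _)"
  unfolding bilinear_conv_bounded_bilinear [symmetric] bilinear_def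
  by (auto intro!: linearI simp: outer_def vec_eq_iff algebra_simps)

lemma hermitian_mat_outer_symmetrized: "hermitian_mat (k *\<^sub>R (outer u v + outer v u))"
  by (simp add: hermitian_mat_def outer_def mult.commute add.commute)

section \<open>The state family and its quantum Fisher information\<close>

text \<open>The last qubit makes the two tensor vectors orthogonal even when
  \<open>\<psi>\<^sub>0\<close> and \<open>\<psi>\<^sub>1\<close> overlap, so everything happens in
  a real Euclidean plane.\<close>

lemma cos_tensor_plus_sin_tensor_dot:
  assumes "norm \<psi>\<^sub>0 = 1" "norm \<psi>\<^sub>1 = 1"
  shows "cdot (a *\<^sub>R tensor_vec \<psi>\<^sub>0 (ket 0) + b *\<^sub>R tensor_vec \<psi>\<^sub>1 (ket (1 :: 2)))
      (a' *\<^sub>R tensor_vec \<psi>\<^sub>0 (ket 0) + b' *\<^sub>R tensor_vec \<psi>\<^sub>1 (ket 1)) = of_real (a * a' + b * b')"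
  using assms
  by (simp add: cdot_add_left cdot_add_right cdot_scaleR_left cdot_scaleR_right cdot_tensor
      cdot_ket cdot_self [of \<psi>\<^sub>0] cdot_self [of \<psi>\<^sub>1])

lemma psi_G_has_vector_derivative:
  "(psi_G N \<psi>\<^sub>0 \<psi>\<^sub>1 has_vector_derivative N *\<^sub>R (- sin (N * \<theta>) *\<^sub>R tensor_vec \<psi>\<^sub>0 (ket 0)
      + cos (N * \<theta>) *\<^sub>R tensor_vec \<psi>\<^sub>1 (ket 1))) (at \<theta>)"
  unfolding psi_G_def
  by (auto intro!: derivative_eq_intros simp: algebra_simps)

lemma rho_G_has_vector_derivative:
  fixes \<psi>\<^sub>0 \<psi>\<^sub>1 :: "complex ^ 'n::finite" and N \<theta> :: real
  defines "\<psi> \<equiv> psi_G N \<psi>\<^sub>0 \<psi>\<^sub>1 \<theta>"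
    and "\<phi> \<equiv> - sin (N * \<theta>) *\<^sub>R tensor_vec \<psi>\<^sub>0 (ket (0 :: 2)) + cos (N * \<theta>) *\<^sub>R tensor_vec \<psi>\<^sub>1 (ket 1)"
  shows "(rho_G r N \<psi>\<^sub>0 \<psi>\<^sub>1 has_vector_derivative
    (r powr N * N) *\<^sub>R (outer \<phi> \<psi> + outer \<psi> \<phi>)) (at \<theta>)"
proof -
  interpret outer: bounded_bilinear "outer :: complex ^ ('n \<times> 2) \<Rightarrow> complex ^ ('n \<times> 2) \<Rightarrow> _"
    by (rule bounded_bilinear_outer)
  have psi: "(psi_G N \<psi>\<^sub>0 \<psi>\<^sub>1 has_vector_derivative N *\<^sub>R \<phi>) (at \<theta>)"
    unfolding \<phi>_def by (rule psi_G_has_vector_derivative)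
  show ?thesis
    unfolding rho_G_def
    by (rule derivative_eq_intros outer.has_vector_derivative psi refl)+
      (simp add: \<psi>_def outer.scaleR_left outer.scaleR_right algebra_simps)
qed

text \<open>On the plane spanned by the orthonormal \<open>\<psi>\<close> and \<open>\<phi>\<close>,
  the state is diagonal with entries \<open>s + e\<close> and \<open>e\<close>, while
  \<open>X\<close> exchanges the two vectors. Their anticommutator is therefore \<open>X\<close>
  times \<open>D = s + 2 * e\<close>.\<close>

lemma F_q_eq:
  fixes \<psi>\<^sub>0 \<psi>\<^sub>1 :: "complex ^ 'n::finite"
  assumes r: "0 < r" "r \<le> 1" and N: "0 < N" and norm: "norm \<psi>\<^sub>0 = 1" "norm \<psi>\<^sub>1 = 1"
  defines "s \<equiv> r powr N"
  shows "F_q r N \<psi>\<^sub>0 \<psi>\<^sub>1 \<theta> = 4 * N\<^sup>2 * s\<^sup>2 / (s + (1 - s) / real CARD('n))"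
proof -
  define \<psi> where "\<psi> = psi_G N \<psi>\<^sub>0 \<psi>\<^sub>1 \<theta>"
  define \<phi> where "\<phi> = - sin (N * \<theta>) *\<^sub>R tensor_vec \<psi>\<^sub>0 (ket (0 :: 2)) + cos (N * \<theta>) *\<^sub>R tensor_vec \<psi>\<^sub>1 (ket 1)"
  define D where "D = s + (1 - s) / real CARD('n)"
  define e where "e = (1 - s) / real CARD('n \<times> 2)"
  define X where "X = outer \<phi> \<psi> + outer \<psi> \<phi>"
  \<comment> \<open>Chosen so that half of \<open>k * D\<close> is \<open>s * N\<close>, the factor
    in the derivative of the state.\<close>
  define k where "k = 2 * s * N / D"
  have s: "0 < s" "s \<le> 1"
    using r N by (auto simp: s_def powr_le1)
  have D: "D > 0"
    using s by (simp add: D_def add_pos_nonneg)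
  have e: "D = s + 2 * e"
    by (simp add: D_def e_def field_simps)
  have dots: "cdot \<psi> \<psi> = 1" "cdot \<phi> \<phi> = 1" "cdot \<psi> \<phi> = 0" "cdot \<phi> \<psi> = 0"
    unfolding \<psi>_def \<phi>_def psi_G_def cos_tensor_plus_sin_tensor_dot [OF norm]
    by (simp_all flip: power2_eq_square)
  have rho: "rho_G r N \<psi>\<^sub>0 \<psi>\<^sub>1 \<theta> = s *\<^sub>R outer \<psi> \<psi> + e *\<^sub>R mat 1"
    by (simp add: rho_G_def s_def e_def \<psi>_def)
  have rhoX: "rho_G r N \<psi>\<^sub>0 \<psi>\<^sub>1 \<theta> ** X = s *\<^sub>R outer \<psi> \<phi> + e *\<^sub>R X"
    and Xrho: "X ** rho_G r N \<psi>\<^sub>0 \<psi>\<^sub>1 \<theta> = s *\<^sub>R outer \<phi> \<psi> + e *\<^sub>R X"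
    unfolding rho X_def matrix_add_ldistrib matrix_add_rdistrib
    by (simp_all add: outer_mult_outer dots vec_eq_iff matrix_scalar_ac scaleR_right_distrib
        flip: scalar_matrix_assoc)
  have "rho_G r N \<psi>\<^sub>0 \<psi>\<^sub>1 \<theta> ** X + X ** rho_G r N \<psi>\<^sub>0 \<psi>\<^sub>1 \<theta> = D *\<^sub>R X"
    unfolding rhoX Xrho e by (simp add: X_def vec_eq_iff scaleR_conv_of_real algebra_simps)
  then have anti: "(1/2) *\<^sub>R (rho_G r N \<psi>\<^sub>0 \<psi>\<^sub>1 \<theta> ** (k *\<^sub>R X) + (k *\<^sub>R X) ** rho_G r N \<psi>\<^sub>0 \<psi>\<^sub>1 \<theta>)
      = (s * N) *\<^sub>R X"
    using D by (simp add: k_def matrix_scalar_ac flip: scalar_matrix_assoc scaleR_right_distrib)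
  have sld: "is_SLD (rho_G r N \<psi>\<^sub>0 \<psi>\<^sub>1) \<theta> (k *\<^sub>R X)"
    unfolding is_SLD_def anti
    using rho_G_has_vector_derivative [of r N \<psi>\<^sub>0 \<psi>\<^sub>1 \<theta>]
    by (simp add: X_def hermitian_mat_outer_symmetrized \<psi>_def \<phi>_def s_def)
  \<comment> \<open>\<open>X ** X\<close> is the orthogonal projection onto that plane, so the trace
    against it is \<open>(s + e) + e = D\<close>.\<close>
  have XX: "X ** X = outer \<phi> \<phi> + outer \<psi> \<psi>"
    unfolding X_def matrix_add_ldistrib matrix_add_rdistrib
    by (simp_all add: outer_mult_outer dots vec_eq_iff)
  have "rho_G r N \<psi>\<^sub>0 \<psi>\<^sub>1 \<theta> ** (X ** X) = s *\<^sub>R outer \<psi> \<psi> + e *\<^sub>R (outer \<phi> \<phi> + outer \<psi> \<psi>)"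
    unfolding rho XX matrix_add_rdistrib
    by (simp add: matrix_add_ldistrib outer_mult_outer dots vec_eq_iff scaleR_right_distrib
        flip: scalar_matrix_assoc)
  then have "trace (rho_G r N \<psi>\<^sub>0 \<psi>\<^sub>1 \<theta> ** (X ** X)) = of_real D"
    by (simp add: trace_add trace_scaleR trace_outer dots e)
  then have "trace (rho_G r N \<psi>\<^sub>0 \<psi>\<^sub>1 \<theta> ** ((k *\<^sub>R X) ** (k *\<^sub>R X))) = of_real (k\<^sup>2 * D)"
    by (simp add: matrix_scalar_ac trace_scaleR power2_eq_square flip: scalar_matrix_assoc)
  also have "k\<^sup>2 * D = 4 * N\<^sup>2 * s\<^sup>2 / D"
    using D by (simp add: k_def power2_eq_square)
  finally show ?thesis
    unfolding F_q_def D_def by (rule quantum_fisher_eqI [OF sld])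
qed

section \<open>Outcome probabilities and classical Fisher information\<close>

lemma trace_mult_E_G: "trace (A ** E_G i) = (\<Sum>a\<in>UNIV. A $ (a, i) $ (a, i))"
proof -
  have "(A ** E_G i) $ p $ p = (if snd p = i then A $ p $ p else 0)" for p
  proof -
    have "(A ** E_G i) $ p $ p = (\<Sum>q\<in>UNIV. if q = p then (if snd p = i then A $ p $ p else 0) else 0)"
      unfolding matrix_matrix_mult_def
      by (auto intro!: sum.cong simp: E_G_def tensor_mat_def mat_def outer_def ket_def axis_def prod_eq_iff)
    then show ?thesis by simp
  qed
  then have "trace (A ** E_G i) = (\<Sum>p\<in>UNIV \<times> UNIV. if snd p = i then A $ p $ p else 0)"
    by (simp add: trace_def)
  also have "\<dots> = (\<Sum>a\<in>UNIV. \<Sum>j\<in>UNIV. if j = i then A $ (a, j) $ (a, j) else 0)"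
    unfolding sum.cartesian_product by (rule sum.cong) auto
  finally show ?thesis by simp
qed

lemma prob_G_eq:
  fixes \<psi>\<^sub>0 \<psi>\<^sub>1 :: "complex ^ 'n::finite"
  assumes "norm \<psi>\<^sub>0 = 1" "norm \<psi>\<^sub>1 = 1"
  shows "prob_G r N \<psi>\<^sub>0 \<psi>\<^sub>1 0 \<theta> = (1 + r powr N * cos (2 * N * \<theta>)) / 2"
    and "prob_G r N \<psi>\<^sub>0 \<psi>\<^sub>1 1 \<theta> = (1 - r powr N * cos (2 * N * \<theta>)) / 2"
proof -
  have norm2: "(\<Sum>a\<in>UNIV. (cmod (v $ a))\<^sup>2) = 1" if "norm v = 1" for v :: "complex ^ 'n"
    using that by (simp add: norm_vec_def L2_set_def)
  \<comment> \<open>The maximally mixed part has \<open>CARD('n)\<close> equal diagonal entries per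
    outcome, so each outcome gets half of its weight whatever the dimension.\<close>
  have diag: "prob_G r N \<psi>\<^sub>0 \<psi>\<^sub>1 i \<theta>
      = r powr N * (\<Sum>a\<in>UNIV. (cmod (psi_G N \<psi>\<^sub>0 \<psi>\<^sub>1 \<theta> $ (a, i)))\<^sup>2) + (1 - r powr N) / 2" for i
  proof -
    have "prob_G r N \<psi>\<^sub>0 \<psi>\<^sub>1 i \<theta>
      = (\<Sum>a::'n\<in>UNIV. r powr N * (cmod (psi_G N \<psi>\<^sub>0 \<psi>\<^sub>1 \<theta> $ (a, i)))\<^sup>2 + (1 - r powr N) / (2 * real CARD('n)))"
      unfolding prob_G_def trace_mult_E_G
      by (simp add: rho_G_def outer_def mat_def mult.commute flip: complex_norm_square)
    then show ?thesis
      by (simp add: sum.distrib sum_distrib_left)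
  qed
  have psi0: "(cmod (psi_G N \<psi>\<^sub>0 \<psi>\<^sub>1 \<theta> $ (a, 0)))\<^sup>2 = (cos (N * \<theta>))\<^sup>2 * (cmod (\<psi>\<^sub>0 $ a))\<^sup>2"
    and psi1: "(cmod (psi_G N \<psi>\<^sub>0 \<psi>\<^sub>1 \<theta> $ (a, 1)))\<^sup>2 = (sin (N * \<theta>))\<^sup>2 * (cmod (\<psi>\<^sub>1 $ a))\<^sup>2" for a
    by (simp_all add: psi_G_def tensor_vec_def ket_def axis_def power_mult_distrib)
  have cos2: "cos (2 * N * \<theta>) = 2 * (cos (N * \<theta>))\<^sup>2 - 1"
    using cos_double_cos [of "N * \<theta>"] by (simp add: mult.assoc)
  show "prob_G r N \<psi>\<^sub>0 \<psi>\<^sub>1 0 \<theta> = (1 + r powr N * cos (2 * N * \<theta>)) / 2"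
    unfolding diag psi0 cos2 sum_distrib_left [symmetric] by (simp add: norm2 assms field_simps)
  show "prob_G r N \<psi>\<^sub>0 \<psi>\<^sub>1 1 \<theta> = (1 - r powr N * cos (2 * N * \<theta>)) / 2"
    unfolding diag psi1 cos2 sum_distrib_left [symmetric] by (simp add: norm2 assms field_simps sin_squared_eq)
qed

lemma deriv_ln_squared_times:
  assumes "(f has_real_derivative f') (at x)" "0 < f x"
  shows "(deriv (\<lambda>t. ln (f t)) x)\<^sup>2 * f x = f'\<^sup>2 / f x"
proof -
  have "((\<lambda>t. ln (f t)) has_real_derivative f' / f x) (at x)"
    using assms by (auto intro!: derivative_eq_intros)
  then show ?thesis
    using assms(2) by (simp add: DERIV_imp_deriv power2_eq_square)
qed

text \<open>
  The formula also holds where a probability vanishes: then \<open>s = 1\<close> and \<open>sin (2 N \<theta>) = 0\<close>, and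
  both sides are \<open>0\<close>, the right-hand one because \<open>0 / 0 = 0\<close>.
\<close>

lemma F_c_eq:
  fixes \<psi>\<^sub>0 \<psi>\<^sub>1 :: "complex ^ 'n::finite"
  assumes r: "0 < r" "r \<le> 1" and N: "0 < N" and norm: "norm \<psi>\<^sub>0 = 1" "norm \<psi>\<^sub>1 = 1"
  defines "s \<equiv> r powr N"
  shows "F_c r N \<psi>\<^sub>0 \<psi>\<^sub>1 \<theta>
    = 4 * N\<^sup>2 * s\<^sup>2 * (sin (2 * N * \<theta>))\<^sup>2 / (1 - s\<^sup>2 * (cos (2 * N * \<theta>))\<^sup>2)"
proof -
  define x where "x = s * cos (2 * N * \<theta>)"
  define y where "y = s * N * sin (2 * N * \<theta>)"
  \<comment> \<open>The sign \<open>\<sigma>\<close> treats both outcomes at once: \<open>1\<close>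
    for outcome \<open>0\<close> and \<open>-1\<close> for outcome \<open>1\<close>.\<close>
  define f where "f \<sigma> t = (1 + \<sigma> * (s * cos (2 * N * t))) / 2" for \<sigma> t
  have s: "0 < s" "s \<le> 1"
    using r N by (auto simp: s_def powr_le1)
  have absx: "\<bar>x\<bar> \<le> s * 1"
    unfolding x_def abs_mult using s by (intro mult_mono) auto
  have summand: "(deriv (\<lambda>t. ln (f \<sigma> t)) \<theta>)\<^sup>2 * f \<sigma> \<theta> = y\<^sup>2 / ((1 + \<sigma> * x) / 2)"
    if \<sigma>: "\<sigma>\<^sup>2 = 1" for \<sigma>
  proof (cases "f \<sigma> \<theta> = 0")
    case True
    \<comment> \<open>The left side has the factor 0; the right side is a division by 0, whose value
      is 0.\<close>
    then show ?thesis by (simp add: f_def x_def)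
  next
    case False
    have "\<bar>\<sigma> * x\<bar> \<le> 1"
      using \<sigma> absx s by (auto simp: abs_mult power2_eq_1_iff)
    then have "0 < f \<sigma> \<theta>"
      using False by (auto simp: f_def x_def abs_le_iff)
    moreover have "(f \<sigma> has_real_derivative - \<sigma> * y) (at \<theta>)"
      unfolding f_def y_def by (auto intro!: derivative_eq_intros)
    ultimately have "(deriv (\<lambda>t. ln (f \<sigma> t)) \<theta>)\<^sup>2 * f \<sigma> \<theta> = (- \<sigma> * y)\<^sup>2 / f \<sigma> \<theta>"
      by (intro deriv_ln_squared_times)
    then show ?thesis
      using \<sigma> by (simp only: power_mult_distrib power2_minus f_def x_def mult_1)
  qed
  \<comment> \<open>Numerals of type \<open>2\<close> are read modulo 2, so the elements
    \<open>1\<close> and \<open>2\<close> listed by \<open>UNIV_2\<close> are the two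
    outcomes.\<close>
  have "(2 :: 2) = 0"
    by simp
  then have UNIV: "(UNIV :: 2 set) = {0, 1}"
    using UNIV_2 by auto
  have "F_c r N \<psi>\<^sub>0 \<psi>\<^sub>1 \<theta> = (deriv (\<lambda>t. ln (f 1 t)) \<theta>)\<^sup>2 * f 1 \<theta> + (deriv (\<lambda>t. ln (f (-1) t)) \<theta>)\<^sup>2 * f (-1) \<theta>"
    by (simp add: F_c_def classical_fisher_def UNIV prob_G_eq [OF norm] f_def s_def)
  also have "\<dots> = y\<^sup>2 / ((1 + x) / 2) + y\<^sup>2 / ((1 - x) / 2)"
    by (simp add: summand)
  also have "\<dots> = 4 * y\<^sup>2 / (1 - x\<^sup>2)"
  proof (cases "x\<^sup>2 = 1")
    \<comment> \<open>Only one of the two denominators vanishes, so the other fraction is 0 only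
      through \<open>y = 0\<close>. This holds because \<open>\<bar>x\<bar> \<le> s \<le> 1\<close>
      forces \<open>s = 1\<close>, and then the squared cosine is 1.\<close>
    case True
    have "1 \<le> s" using True absx by (auto simp: power2_eq_1_iff)
    then have "s = 1" using s by simp
    then have "(sin (2 * N * \<theta>))\<^sup>2 = 0" using True by (simp add: x_def sin_squared_eq)
    then have "y = 0" by (simp add: y_def)
    then show ?thesis by simp
  next
    case False
    moreover have "1 - x\<^sup>2 = (1 + x) * (1 - x)"
      by (simp add: algebra_simps power2_eq_square)
    ultimately have "1 + x \<noteq> 0" "1 - x \<noteq> 0" "1 - x\<^sup>2 = (1 + x) * (1 - x)"
      by auto
    then show ?thesis by (simp add: field_simps)
  qed
  finally show ?thesis
    by (simp add: x_def y_def power_mult_distrib mult_ac)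
qed

section \<open>The envelope and the comparison\<close>

text \<open>As \<open>s \<le> 1\<close>, the squared sine, being 1 minus the squared cosine, is at
  most the denominator; where the denominator is 0, so is the quotient.\<close>

lemma F_c_le:
  fixes \<psi>\<^sub>0 \<psi>\<^sub>1 :: "complex ^ 'n::finite"
  assumes r: "0 < r" "r \<le> 1" and N: "0 < N" and norm: "norm \<psi>\<^sub>0 = 1" "norm \<psi>\<^sub>1 = 1"
  shows "F_c r N \<psi>\<^sub>0 \<psi>\<^sub>1 \<theta> \<le> 4 * N\<^sup>2 * (r powr N)\<^sup>2"
proof -
  define s where "s = r powr N"
  have "0 < s" "s \<le> 1"
    using r N by (auto simp: s_def powr_le1)
  then have "s\<^sup>2 * (cos (2 * N * \<theta>))\<^sup>2 \<le> 1 * (cos (2 * N * \<theta>))\<^sup>2"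
    by (intro mult_right_mono) (auto simp: power_le_one)
  then have sin_le: "(sin (2 * N * \<theta>))\<^sup>2 \<le> 1 - s\<^sup>2 * (cos (2 * N * \<theta>))\<^sup>2"
    by (simp add: sin_squared_eq)
  then have "(sin (2 * N * \<theta>))\<^sup>2 / (1 - s\<^sup>2 * (cos (2 * N * \<theta>))\<^sup>2) \<le> 1"
    using order_trans [OF zero_le_power2 sin_le] by (auto simp: divide_le_eq_1)
  then have "4 * N\<^sup>2 * s\<^sup>2 * ((sin (2 * N * \<theta>))\<^sup>2 / (1 - s\<^sup>2 * (cos (2 * N * \<theta>))\<^sup>2)) \<le> 4 * N\<^sup>2 * s\<^sup>2"
    by (intro mult_left_le) auto
  then show ?thesis
    by (simp add: F_c_eq [OF assms] s_def)
qed

lemma F_c_env_eq: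
  fixes \<psi>\<^sub>0 \<psi>\<^sub>1 :: "complex ^ 'n::finite"
  assumes "0 < r" "r \<le> 1" "0 < N" "norm \<psi>\<^sub>0 = 1" "norm \<psi>\<^sub>1 = 1"
  shows "F_c_env r N \<psi>\<^sub>0 \<psi>\<^sub>1 = 4 * N\<^sup>2 * (r powr N)\<^sup>2"
  unfolding F_c_env_def
proof (rule cSup_eq_maximum)
  \<comment> \<open>At this angle the cosine vanishes and the sine is 1, so the upper bound is
    attained.\<close>
  have "2 * N * (pi / (4 * N)) = pi / 2"
    using \<open>0 < N\<close> by simp
  then have "F_c r N \<psi>\<^sub>0 \<psi>\<^sub>1 (pi / (4 * N)) = 4 * N\<^sup>2 * (r powr N)\<^sup>2"
    unfolding F_c_eq [OF assms] by simp
  then show "4 * N\<^sup>2 * (r powr N)\<^sup>2 \<in> range (F_c r N \<psi>\<^sub>0 \<psi>\<^sub>1)"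
    by (metis rangeI)
qed (use F_c_le [OF assms] in auto)

text \<open>Strictness in (ii) is claimed for \<open>r < 1\<close>: at \<open>r = 1\<close> the
  state is pure, \<open>s = D = 1\<close>, and the quantum value equals the envelope in every
  dimension.\<close>

theorem mainTheorem4:
  fixes n d :: nat and r N :: real and \<psi>\<^sub>0 \<psi>\<^sub>1 :: "complex ^ 'n::finite"
  assumes "CARD('n) = 2 ^ n"
    and "d = 2 ^ (n + 1)"
    and "0 < r" and "r \<le> 1"
    and "0 < N"
    and "norm \<psi>\<^sub>0 = 1" and "norm \<psi>\<^sub>1 = 1"
  shows "(\<forall>\<theta> \<theta>'. F_q r N \<psi>\<^sub>0 \<psi>\<^sub>1 \<theta> = F_q r N \<psi>\<^sub>0 \<psi>\<^sub>1 \<theta>')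
    \<and> (\<forall>\<theta>. F_q r N \<psi>\<^sub>0 \<psi>\<^sub>1 \<theta> \<ge> F_c_env r N \<psi>\<^sub>0 \<psi>\<^sub>1
           \<and> F_c_env r N \<psi>\<^sub>0 \<psi>\<^sub>1 \<ge> F_c r N \<psi>\<^sub>0 \<psi>\<^sub>1 \<theta>)
    \<and> (d = 2 \<longrightarrow> (\<forall>\<theta>. F_q r N \<psi>\<^sub>0 \<psi>\<^sub>1 \<theta> = F_c_env r N \<psi>\<^sub>0 \<psi>\<^sub>1))
    \<and> (d > 2 \<and> r < 1 \<longrightarrow> (\<forall>\<theta>. F_q r N \<psi>\<^sub>0 \<psi>\<^sub>1 \<theta> > F_c_env r N \<psi>\<^sub>0 \<psi>\<^sub>1))"
proof -
  note hyps = \<open>0 < r\<close> \<open>r \<le> 1\<close> \<open>0 < N\<close> \<open>norm \<psi>\<^sub>0 = 1\<close> \<open>norm \<psi>\<^sub>1 = 1\<close>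
  define s where "s = r powr N"
  define m where "m = real CARD('n)"
  define V where "V = 4 * N\<^sup>2 * s\<^sup>2"
  define D where "D = s + (1 - s) / m"
  have F_q: "F_q r N \<psi>\<^sub>0 \<psi>\<^sub>1 \<theta> = V / D" for \<theta>
    by (simp add: F_q_eq [OF hyps] V_def D_def s_def m_def)
  have env: "F_c_env r N \<psi>\<^sub>0 \<psi>\<^sub>1 = V"
    by (simp add: F_c_env_eq [OF hyps] V_def s_def)
  have s: "0 < s" "s \<le> 1"
    using hyps by (auto simp: s_def powr_le1)
  have m: "1 \<le> m" "d = 2 * m"
    using assms(1,2) by (auto simp: m_def)
  have "V > 0"
    using s \<open>0 < N\<close> by (simp add: V_def)
  \<comment> \<open>The first factor vanishes exactly without noise, the second exactly for a single
    qubit (\<open>m = 1\<close>); otherwise both are positive.\<close>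
  have D1: "1 - D = (1 - s) * (1 - 1 / m)"
    by (simp add: D_def algebra_simps)
  have "D > 0"
    using s m by (simp add: D_def add_pos_nonneg)
  have "D \<le> 1"
    using D1 s m by (smt (verit) divide_le_eq_1 mult_nonneg_nonneg)
  then have "V \<le> V / D"
    using \<open>D > 0\<close> \<open>V > 0\<close> by (simp add: field_simps)
  moreover have "F_c r N \<psi>\<^sub>0 \<psi>\<^sub>1 \<theta> \<le> V" for \<theta>
    using F_c_le [OF hyps] by (simp add: V_def s_def)
  moreover have "V / D = V" if "d = 2"
    using m that D1 by simp
  moreover have "V < V / D" if "d > 2" "r < 1"
  proof -
    have "s < 1"
      using that(2) hyps powr_less_mono2 [of N r 1] by (simp add: s_def)
    moreover have "m > 1"
      using that(1) m by linarith
    ultimately have "1 - D > 0"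
      unfolding D1 by (intro mult_pos_pos) auto
    then show ?thesis
      using \<open>D > 0\<close> \<open>V > 0\<close> by (simp add: field_simps)
  qed
  ultimately show ?thesis
    unfolding F_q env by blast
qed

end
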